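(* Let $E_j(x)$ be the Euler polynomials and $\overline{\mathcal{H}}_n:=\sum_{j=0}^n\frac{1}{2j+1}$. For all $n\ge1$, $$\frac{H_{2n}\big(E_{k+3}(1)\big)}{H_{2n-1}\big(E_{k+3}(1)\big)}=-\frac{(n+1)(2n+1)!^2}{2^{4n+2}},$$ and $$H_{2n}\big(E_{k+3}(1)\big)=\frac{(-1)^{n+1}\cdot\overline{\mathcal{H}}_n}{2^{3n+2}}\cdot\prod_{\ell=1}^n\left(\frac{\ell^3(\ell+1)(2\ell+1)^3(2\ell-1)}{16}\right)^{n+1-\ell},$$ $$H_{2n-1}\big(E_{k+3}(1)\big)=\frac{(-1)^n\cdot2^n\cdot\overline{\mathcal{H}}_n}{(n+1)(2n+1)!^2}\cdot\prod_{\ell=1}^n\left(\frac{\ell^3(\ell+1)(2\ell+1)^3(2\ell-1)}{16}\right)^{n+1-\ell}.$$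
   Context: For a sequence $(a_k)_{k\ge 0}$ and $n\ge 0$, $H_n(a_k):=\det(a_{i+j})_{0\le i,j\le n}$ denotes the $(n+1)\times(n+1)$ Hankel determinant; here the sequence is $(E_{k+3}(1))_{k\ge0}$. The Euler polynomials are defined by $\frac{2e^{xt}}{e^t+1}=\sum_{n\ge0}E_n(x)\frac{t^n}{n!}$. The notation $(2n+1)!^2$ means $((2n+1)!)^2$. *)

theory Defs
  imports
    "HOL-Computational_Algebra.Formal_Power_Series"
    "Jordan_Normal_Form.Determinant"
    Complex_Main
begin

definition euler_poly :: "nat \<Rightarrow> real \<Rightarrow> real" where
  "euler_poly n x = fact n * fps_nth (2 * fps_exp x / (fps_exp 1 + 1)) n"

text \<open>The denominator has constant term 2, so the quotient above is a genuine quotient of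
  formal power series, and the values are polynomial in \<open>x\<close>.\<close>

lemma euler_poly_generating_function:
  "(fps_exp 1 + 1) * Abs_fps (\<lambda>n. euler_poly n x / fact n) = 2 * fps_exp x"
proof -
  have "fps_nth (fps_exp 1 + 1 :: real fps) 0 \<noteq> 0"
    by simp
  then have "2 * fps_exp x / (fps_exp 1 + 1) * (fps_exp 1 + 1) = 2 * fps_exp (x :: real)"
    by (simp add: fps_divide_unit mult.assoc inverse_mult_eq_1)
  moreover have "Abs_fps (\<lambda>n. euler_poly n x / fact n) = 2 * fps_exp x / (fps_exp 1 + 1)"
    by (rule fps_ext) (simp add: euler_poly_def)
  ultimately show ?thesis
    by (simp add: mult.commute)
qed

lemma euler_poly_is_polynomial: "\<exists>p. \<forall>x. euler_poly n x = poly p x"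
proof -
  define G where "G = inverse (fps_exp 1 + 1 :: real fps)"
  define p where "p = (\<Sum>i\<le>n. monom (2 * fact n / fact i * fps_nth G (n - i)) i)"
  have "euler_poly n x = poly p x" for x
  proof -
    have "2 * fps_exp x / (fps_exp 1 + 1) = fps_const 2 * (fps_exp x * G)"
      by (simp add: G_def fps_divide_unit mult.assoc numeral_fps_const)
    then have "euler_poly n x = fact n * (2 * (\<Sum>i\<le>n. x ^ i / fact i * fps_nth G (n - i)))"
      unfolding euler_poly_def by (simp only: fps_mult_left_const_nth)
        (simp add: fps_mult_nth atLeast0AtMost)
    then show ?thesis
      by (simp add: p_def poly_sum poly_monom sum_distrib_left mult_ac)
  qed
  then show ?thesis by blast
qed

definition hankel_det :: "(nat \<Rightarrow> real) \<Rightarrow> nat \<Rightarrow> real" where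
  "hankel_det a n = det (mat (n + 1) (n + 1) (\<lambda>(i, j). a (i + j)))"

definition odd_harm :: "nat \<Rightarrow> real" where
  "odd_harm n = (\<Sum>j = 0..n. 1 / (2 * real j + 1))"

end

theory Submission
  imports Defs
begin

text \<open>Let \<open>T = tanh (t / 2)\<close>, so that \<open>1 + T\<close> generates \<open>E\<^sub>n(1)\<close> and \<open>2 T' = 1 - T\<^sup>2\<close>. The derivatives
  \<open>L i n\<close> of order \<open>i\<close> at \<open>0\<close> of \<open>(1 - T\<^sup>2) T ^ n\<close> form a triangular array whose row shift is a
  tridiagonal operator \<open>J\<close>, self-adjoint for the weights \<open>(-1) ^ n (n + 1)\<close>. Hence
  \<open>2 E\<^bsub>i+j+1\<^esub>(1) = (L D L\<^sup>T) i j\<close> with \<open>D\<close> the diagonal matrix of weights, and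
  \<open>2 E\<^bsub>i+j+3\<^esub>(1) = (L (J D J\<^sup>T) L\<^sup>T) i j\<close>. As \<open>J\<close> has zero diagonal, \<open>J D J\<^sup>T\<close> only couples indices
  at distance \<open>0\<close> and \<open>2\<close>, and its elimination pivots solve a first-order recurrence in steps of
  two: the even ones are polynomial in the index, while the odd ones carry the quotient of two
  consecutive odd harmonic numbers. The Hankel determinants are the products of these pivots.\<close>

section \<open>Hankel determinants from triangular factorisations\<close>

text \<open>With the weights \<open>d\<close> absorbed into one factor, the matrix is a lower
  triangular matrix times the transpose of another.\<close>

lemma hankel_det_LDL:
  assumes decomp: "\<And>i j. i \<le> N \<Longrightarrow> j \<le> N \<Longrightarrow> a (i + j) = (\<Sum>k\<le>N. d k * g i k * g j k)"
    and lower: "\<And>i k. i < k \<Longrightarrow> g i k = 0"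
  shows "hankel_det a N = (\<Prod>k\<le>N. d k * (g k k)\<^sup>2)"
proof -
  define A where "A = mat (N + 1) (N + 1) (\<lambda>(i, k). d k * g i k)"
  define B where "B = mat (N + 1) (N + 1) (\<lambda>(i, k). g i k)"
  have carrier: "A \<in> carrier_mat (N + 1) (N + 1)" "B \<in> carrier_mat (N + 1) (N + 1)"
    by (simp_all add: A_def B_def)
  have "mat (N + 1) (N + 1) (\<lambda>(i, j). a (i + j)) = A * transpose_mat B"
  proof (rule eq_matI)
    fix i j
    assume "i < dim_row (A * transpose_mat B)" "j < dim_col (A * transpose_mat B)"
    then have ij: "i < N + 1" "j < N + 1"
      by (simp_all add: A_def B_def)
    have "(A * transpose_mat B) $$ (i, j) = (\<Sum>k\<in>{0..<N + 1}. d k * g i k * g j k)"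
      using ij by (simp add: A_def B_def scalar_prod_def del: sum.op_ivl_Suc)
    also have "{0..<N + 1} = {..N}"
      by auto
    finally show "mat (N + 1) (N + 1) (\<lambda>(i, j). a (i + j)) $$ (i, j) = (A * transpose_mat B) $$ (i, j)"
      using ij decomp[of i j] by simp
  qed (simp_all add: A_def B_def)
  then have "hankel_det a N = det A * det B"
    using carrier by (simp add: hankel_det_def det_mult[of _ "N + 1"] det_transpose[of _ "N + 1"])
  also have "det A = (\<Prod>k\<le>N. d k * g k k)"
  proof -
    have "det A = prod_list (diag_mat A)"
      by (rule det_lower_triangular[OF _ carrier(1)]) (auto simp: A_def lower)
    also have "\<dots> = (\<Prod>k\<in>{0..<N + 1}. A $$ (k, k))"
      using carrier by (subst prod_list_diag_prod) simp
    also have "\<dots> = (\<Prod>k\<le>N. d k * g k k)"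
      by (rule prod.cong) (auto simp: A_def)
    finally show ?thesis .
  qed
  also have "det B = (\<Prod>k\<le>N. g k k)"
  proof -
    have "det B = prod_list (diag_mat B)"
      by (rule det_lower_triangular[OF _ carrier(2)]) (auto simp: B_def lower)
    also have "\<dots> = (\<Prod>k\<in>{0..<N + 1}. B $$ (k, k))"
      using carrier by (subst prod_list_diag_prod) simp
    also have "\<dots> = (\<Prod>k\<le>N. g k k)"
      by (rule prod.cong) (auto simp: B_def)
    finally show ?thesis .
  qed
  finally show ?thesis
    by (simp add: prod.distrib[symmetric] power2_eq_square mult.assoc)
qed

section \<open>The series \<open>tanh (t / 2)\<close> and its coefficient array\<close>

text \<open>Written as the Euler generating function at 1 minus 1, so that coefficients of positive
  index agree by unfolding.\<close>

definition tanh_half_fps :: "real fps" where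
  "tanh_half_fps = 2 * fps_exp 1 / (fps_exp 1 + 1) - 1"

lemma fps_deriv_tanh_half: "2 * fps_deriv tanh_half_fps = 1 - tanh_half_fps\<^sup>2"
proof -
  define Q :: "real fps" where "Q = 2 * fps_exp 1 / (fps_exp 1 + 1)"
  define e :: "real fps" where "e = fps_exp 1"
  have nz: "fps_nth (e + 1) 0 \<noteq> 0"
    by (simp add: e_def)
  then have Q: "Q * (e + 1) = 2 * e"
    by (simp add: Q_def e_def fps_divide_unit mult.assoc inverse_mult_eq_1)
  have e': "fps_deriv e = e"
    by (simp add: e_def)
  have "fps_deriv (Q * (e + 1)) = fps_deriv (2 * e)"
    using Q by simp
  then have Q': "fps_deriv Q * (e + 1) + Q * e = 2 * e"
    by (simp add: e' algebra_simps)
  have "(2 * fps_deriv Q) * (e + 1) = 2 * (fps_deriv Q * (e + 1) + Q * e) - (2 * e) * Q"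
    by (simp add: algebra_simps)
  also have "\<dots> = (2 * e) * (2 - Q)"
    unfolding Q' by (simp add: algebra_simps)
  \<comment> \<open>Trading \<open>2 * e\<close> for \<open>Q * (e + 1)\<close> makes
    \<open>e + 1\<close> a common factor, which cancels.\<close>
  also have "\<dots> = (Q * (2 - Q)) * (e + 1)"
    unfolding Q[symmetric] by (simp only: mult_ac)
  finally have "(2 * fps_deriv Q) * (e + 1) = (Q * (2 - Q)) * (e + 1)" .
  moreover have "e + 1 \<noteq> 0"
    using nz by force
  ultimately have ode: "2 * fps_deriv Q = Q * (2 - Q)"
    by simp
  have T: "tanh_half_fps = Q - 1"
    by (simp add: tanh_half_fps_def Q_def)
  show ?thesis
    unfolding T using ode by (simp add: power2_eq_square algebra_simps)
qed

definition tanh_coeff :: "nat \<Rightarrow> nat \<Rightarrow> real" where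
  "tanh_coeff i n = fact i * fps_nth ((1 - tanh_half_fps\<^sup>2) * tanh_half_fps ^ n) i"

lemma tanh_half_nth_0: "fps_nth tanh_half_fps 0 = 0"
  by (simp add: tanh_half_fps_def fps_divide_unit)

lemma tanh_coeff_0: "tanh_coeff 0 n = (if n = 0 then 1 else 0)"
  by (simp add: tanh_coeff_def tanh_half_nth_0 fps_mult_nth_0 fps_power_zeroth power2_eq_square)

text \<open>Differentiate \<open>(1 - T\<^sup>2) * T ^ n\<close> and replace \<open>2 * T'\<close>
  by \<open>1 - T\<^sup>2\<close>. At \<open>n = 0\<close> the truncated \<open>n - 1\<close> is
  harmless because its coefficient is 0.\<close>

lemma tanh_coeff_Suc:
  "tanh_coeff (Suc i) n =
     (real n * tanh_coeff i (n - 1) - (real n + 2) * tanh_coeff i (n + 1)) / 2"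
proof -
  define T where "T = tanh_half_fps"
  define F where "F n = (1 - T\<^sup>2) * T ^ n" for n
  have T': "2 * fps_deriv T = 1 - T\<^sup>2"
    unfolding T_def by (rule fps_deriv_tanh_half)
  have "2 * fps_deriv (F n) = of_nat n * F (n - 1) - of_nat (n + 2) * F (n + 1)"
  proof (cases n)
    case 0
    have "2 * fps_deriv (F 0) = - 2 * T * (2 * fps_deriv T)"
      by (simp add: F_def power2_eq_square algebra_simps)
    then show ?thesis
      unfolding T' using 0 by (simp add: F_def)
  next
    case (Suc m)
    have "fps_deriv (T ^ n) = of_nat n * fps_deriv T * T ^ m"
      using Suc by (simp only: fps_deriv_power' diff_Suc_1)
    then have "2 * fps_deriv (F n) =
        of_nat n * (1 - T\<^sup>2) * T ^ m * (2 * fps_deriv T) - 2 * T * T ^ n * (2 * fps_deriv T)"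
      unfolding F_def by (simp add: power2_eq_square algebra_simps)
    then show ?thesis
      unfolding T' using Suc by (simp add: F_def power2_eq_square algebra_simps)
  qed
  then have "2 * fps_nth (fps_deriv (F n)) i =
      real n * fps_nth (F (n - 1)) i - (real n + 2) * fps_nth (F (n + 1)) i"
    by (metis (no_types, lifting) fps_mult_left_const_nth fps_of_nat fps_sub_nth numeral_fps_const
        of_nat_add of_nat_numeral)
  then have "fact i * (2 * fps_nth (fps_deriv (F n)) i) =
      fact i * (real n * fps_nth (F (n - 1)) i - (real n + 2) * fps_nth (F (n + 1)) i)"
    by simp
  then show ?thesis
    unfolding tanh_coeff_def T_def[symmetric] F_def[symmetric]
    by (simp add: algebra_simps)
qed

lemma tanh_coeff_eq_0: "i < n \<Longrightarrow> tanh_coeff i n = 0"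
proof (induction i arbitrary: n)
  case 0
  then show ?case by (simp add: tanh_coeff_0)
next
  case (Suc i)
  then show ?case by (simp add: tanh_coeff_Suc)
qed

lemma tanh_coeff_diag: "tanh_coeff i i = fact i / 2 ^ i"
  by (induction i) (simp_all add: tanh_coeff_0 tanh_coeff_Suc tanh_coeff_eq_0)

lemma euler_poly_eq_tanh_coeff: "euler_poly (Suc k) 1 = tanh_coeff k 0 / 2"
proof -
  have "2 * fps_nth (fps_deriv tanh_half_fps) k = fps_nth (1 - tanh_half_fps\<^sup>2) k"
    using fps_deriv_tanh_half by (metis fps_mult_left_const_nth numeral_fps_const)
  then have "fps_nth (1 - tanh_half_fps\<^sup>2) k = 2 * (real (Suc k) * fps_nth tanh_half_fps (Suc k))"
    by (simp del: of_nat_Suc)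
  moreover have "fps_nth tanh_half_fps (Suc k) = euler_poly (Suc k) 1 / fact (Suc k)"
    by (simp add: tanh_half_fps_def euler_poly_def del: fact_Suc)
  ultimately show ?thesis
    by (simp add: tanh_coeff_def)
qed

section \<open>Weights and the bilinear form of the coefficient rows\<close>

definition tanh_wt :: "nat \<Rightarrow> real" where
  "tanh_wt n = (-1) ^ n * (real n + 1)"

text \<open>Self-adjointness of \<open>J\<close>, up to the boundary term of the truncation at \<open>K\<close>.\<close>

lemma tanh_wt_self_adjoint:
  "(\<Sum>n\<le>K. tanh_wt n * ((real n * a (n - 1) - (real n + 2) * a (n + 1)) * b n -
      a n * (real n * b (n - 1) - (real n + 2) * b (n + 1)))) =
   tanh_wt K * (real K + 2) * (a K * b (Suc K) - a (Suc K) * b K)"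
  by (induction K) (simp_all add: tanh_wt_def algebra_simps)

text \<open>Self-adjointness moves one application of \<open>J\<close> at a time from the first row
  to the second, until the first is row 0, a unit vector.\<close>

lemma tanh_coeff_sum:
  "i + j \<le> K \<Longrightarrow> (\<Sum>n\<le>K. tanh_wt n * tanh_coeff i n * tanh_coeff j n) = tanh_coeff (i + j) 0"
proof (induction i arbitrary: j)
  case 0
  have "(\<Sum>n\<le>K. tanh_wt n * tanh_coeff 0 n * tanh_coeff j n) =
      (\<Sum>n\<le>K. if n = 0 then tanh_coeff j 0 else 0)"
    by (rule sum.cong) (simp_all add: tanh_coeff_0 tanh_wt_def)
  then show ?case
    by simp
next
  case (Suc i)
  have "(\<Sum>n\<le>K. tanh_wt n * tanh_coeff (Suc i) n * tanh_coeff j n) -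
      (\<Sum>n\<le>K. tanh_wt n * tanh_coeff i n * tanh_coeff (Suc j) n) =
      (\<Sum>n\<le>K. tanh_wt n * ((real n * tanh_coeff i (n - 1) - (real n + 2) * tanh_coeff i (n + 1)) *
        tanh_coeff j n - tanh_coeff i n *
        (real n * tanh_coeff j (n - 1) - (real n + 2) * tanh_coeff j (n + 1)))) / 2"
    unfolding sum_subtractf[symmetric] sum_divide_distrib
    by (rule sum.cong) (simp_all add: tanh_coeff_Suc field_simps)
  also have "\<dots> = 0"
    \<comment> \<open>Since \<open>i < K\<close>, row \<open>i\<close> vanishes at \<open>K\<close>
      and \<open>Suc K\<close>, so the boundary term is 0.\<close>
    using Suc.prems by (subst tanh_wt_self_adjoint) (simp add: tanh_coeff_eq_0)
  finally show ?case
    using Suc.IH[of "Suc j"] Suc.prems by simp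
qed

section \<open>Odd harmonic numbers and elimination pivots\<close>

lemma odd_harm_pos: "odd_harm n > 0"
  unfolding odd_harm_def by (rule sum_pos) (auto intro!: divide_pos_pos add_nonneg_pos)

lemma odd_harm_Suc: "odd_harm (Suc n) = odd_harm n + 1 / (2 * real n + 3)"
  by (simp add: odd_harm_def)

definition pivot_ratio :: "nat \<Rightarrow> real" where
  "pivot_ratio k = (if even k then 1 else odd_harm (Suc (k div 2)) / odd_harm (k div 2))"

definition pivot :: "nat \<Rightarrow> real" where
  "pivot k = (-1) ^ Suc k * (real k + 1)\<^sup>2 * (real k + 2) * pivot_ratio k"

definition subdiag :: "nat \<Rightarrow> real" where
  "subdiag k = - (real k + 3) / ((real k + 1) * pivot_ratio k)"

lemma pivot_ratio_pos: "pivot_ratio k > 0"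
  by (simp add: pivot_ratio_def odd_harm_pos)

text \<open>For even \<open>k\<close> this is linear arithmetic. For odd \<open>k\<close>, with
  \<open>h\<close> the middle one of three consecutive odd harmonic numbers, both sides equal
  \<open>k + 4 + 1 / h\<close>.\<close>

lemma pivot_ratio_Suc_Suc:
  "(real k + 4) * pivot_ratio (k + 2) = 2 * (real k + 3) - (real k + 2) / pivot_ratio k"
proof (cases "even k")
  case True
  then show ?thesis by (simp add: pivot_ratio_def)
next
  case False
  then obtain m where k: "k = 2 * m + 1"
    by (elim oddE)
  define h where "h = odd_harm (Suc m)"
  have h: "h > 0"
    by (simp add: h_def odd_harm_pos)
  have r: "pivot_ratio k = h / odd_harm m" "pivot_ratio (k + 2) = odd_harm (Suc (Suc m)) / h"
    by (simp_all add: k pivot_ratio_def h_def)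
  have "odd_harm m = h - 1 / (real k + 2)"
    by (simp add: h_def odd_harm_Suc k)
  moreover have "odd_harm (Suc (Suc m)) = h + 1 / (real k + 4)"
    by (simp add: h_def odd_harm_Suc[of "Suc m"] k)
  moreover have "odd_harm m \<noteq> 0"
    using odd_harm_pos[of m] by simp
  ultimately show ?thesis
    unfolding r using h by (simp add: field_simps)
qed

text \<open>The right side is the entry of \<open>J D J\<^sup>T\<close> coupling \<open>k\<close>
  and \<open>k + 2\<close>; this fixes the multiplier \<open>subdiag k\<close>.\<close>

lemma pivot_mult_subdiag:
  "pivot k * subdiag k = - tanh_wt (Suc k) * (real k + 1) * (real k + 3)"
proof -
  define x where "x = real k + 1"
  have "x \<noteq> 0" "pivot_ratio k \<noteq> 0"
    using pivot_ratio_pos[of k] by (simp_all add: x_def)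
  moreover have "tanh_wt (Suc k) = (-1) ^ Suc k * (real k + 2)"
    by (simp add: tanh_wt_def)
  ultimately show ?thesis
    unfolding pivot_def subdiag_def x_def[symmetric]
    by (simp add: power2_eq_square) (simp add: algebra_simps)
qed

text \<open>The elimination step: the diagonal entry at \<open>k + 2\<close>, with contributions
  from the weights at \<open>k + 1\<close> and \<open>k + 3\<close>, is the new pivot plus what
  column \<open>k\<close> removes.\<close>

lemma pivot_mult_subdiag_sq:
  "pivot k * (subdiag k)\<^sup>2 =
     tanh_wt (Suc k) * (real k + 3)\<^sup>2 + tanh_wt (Suc (Suc (Suc k))) * (real k + 3)\<^sup>2 - pivot (k + 2)"
proof -
  have "pivot (k + 2) = (-1) ^ Suc k * (real k + 3)\<^sup>2 * ((real k + 4) * pivot_ratio (k + 2))"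
    by (simp add: pivot_def algebra_simps)
  also have "\<dots> = (-1) ^ Suc k * (real k + 3)\<^sup>2 * (2 * (real k + 3) - (real k + 2) / pivot_ratio k)"
    by (simp only: pivot_ratio_Suc_Suc)
  finally have "pivot (k + 2) = \<dots>" .
  moreover have "pivot k * (subdiag k)\<^sup>2 = (-1) ^ Suc k * (real k + 3)\<^sup>2 * ((real k + 2) / pivot_ratio k)"
    using pivot_ratio_pos[of k]
    by (simp add: pivot_def subdiag_def power2_eq_square divide_simps) (simp add: algebra_simps)
  ultimately show ?thesis
    by (simp add: tanh_wt_def power3_eq_cube algebra_simps)
qed

text \<open>The last two summands are the boundary terms of the truncation at \<open>K\<close>.\<close>

lemma shifted_form_diagonalisation:
  "(\<Sum>n\<le>K. tanh_wt n * (real n * a (n - 1) - (real n + 2) * a (n + 1)) *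
      (real n * b (n - 1) - (real n + 2) * b (n + 1))) =
   (\<Sum>k<K. pivot k * (a k + subdiag k * a (k + 2)) * (b k + subdiag k * b (k + 2))) +
   (pivot K - tanh_wt (K + 1) * (real K + 1)\<^sup>2) * a K * b K +
   (pivot (K + 1) - tanh_wt (K + 2) * (real K + 2)\<^sup>2) * a (K + 1) * b (K + 1)"
proof (induction K)
  case 0
  show ?case
    \<comment> \<open>The two initial values of the two-step recurrence enter here:
      \<open>pivot 0 = -2\<close> and \<open>pivot 1 = 16\<close>.\<close>
    by (simp add: pivot_def tanh_wt_def pivot_ratio_def odd_harm_def)
next
  case (Suc K)
  have "pivot K * (a K + subdiag K * a (K + 2)) * (b K + subdiag K * b (K + 2)) =
      pivot K * a K * b K + pivot K * subdiag K * (a K * b (K + 2) + a (K + 2) * b K) +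
      pivot K * (subdiag K)\<^sup>2 * a (K + 2) * b (K + 2)"
    by (simp add: power2_eq_square algebra_simps)
  note expand = this[unfolded pivot_mult_subdiag pivot_mult_subdiag_sq]
  show ?case
    unfolding sum.atMost_Suc sum.lessThan_Suc Suc.IH expand
    by (simp add: power2_eq_square algebra_simps)
qed

section \<open>Factorisation of the shifted Hankel matrix\<close>

text \<open>The product of \<open>L\<close> with the unit triangular factor of
  \<open>J D J\<^sup>T\<close>; it stays lower triangular with the diagonal of
  \<open>L\<close>.\<close>

definition shifted_coeff :: "nat \<Rightarrow> nat \<Rightarrow> real" where
  "shifted_coeff i k = tanh_coeff i k + subdiag k * tanh_coeff i (k + 2)"

lemma euler_poly_shifted_decomp:
  assumes "i \<le> N" "j \<le> N"
  shows "euler_poly (i + j + 3) 1 =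
    (\<Sum>k\<le>N. pivot k / 8 * shifted_coeff i k * shifted_coeff j k)"
proof -
  \<comment> \<open>Large enough for \<open>tanh_coeff_sum\<close>, for the boundary terms to
    vanish, and to exceed \<open>N\<close>.\<close>
  define K where "K = Suc (i + j + 2 + N)"
  have "euler_poly (i + j + 3) 1 = tanh_coeff (Suc i + Suc j) 0 / 2"
    using euler_poly_eq_tanh_coeff[of "i + j + 2"] by (simp add: eval_nat_numeral)
  also have "\<dots> = (\<Sum>n\<le>K. tanh_wt n * tanh_coeff (Suc i) n * tanh_coeff (Suc j) n) / 2"
    by (subst tanh_coeff_sum) (simp_all add: K_def)
  \<comment> \<open>The 8 collects the existing 2 and one 2 from each use of the recurrence.\<close>
  also have "\<dots> = (\<Sum>n\<le>K. tanh_wt n *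
      (real n * tanh_coeff i (n - 1) - (real n + 2) * tanh_coeff i (n + 1)) *
      (real n * tanh_coeff j (n - 1) - (real n + 2) * tanh_coeff j (n + 1))) / 8"
    unfolding sum_divide_distrib by (rule sum.cong) (simp_all add: tanh_coeff_Suc)
  also have "\<dots> = (\<Sum>k<K. pivot k * shifted_coeff i k * shifted_coeff j k) / 8"
    unfolding shifted_form_diagonalisation shifted_coeff_def
    by (simp add: tanh_coeff_eq_0 K_def del: sum.lessThan_Suc)
  also have "(\<Sum>k<K. pivot k * shifted_coeff i k * shifted_coeff j k) =
      (\<Sum>k\<le>N. pivot k * shifted_coeff i k * shifted_coeff j k)"
    using assms
    by (intro sum.mono_neutral_right) (auto simp: K_def shifted_coeff_def tanh_coeff_eq_0)
  finally show ?thesis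
    by (simp add: sum_divide_distrib)
qed

lemma hankel_det_euler_shifted:
  "hankel_det (\<lambda>k. euler_poly (k + 3) 1) N = (\<Prod>k\<le>N. pivot k / 8 * (fact k / 2 ^ k)\<^sup>2)"
proof -
  have "hankel_det (\<lambda>k. euler_poly (k + 3) 1) N =
      (\<Prod>k\<le>N. pivot k / 8 * (shifted_coeff k k)\<^sup>2)"
    by (rule hankel_det_LDL)
      (simp_all add: euler_poly_shifted_decomp shifted_coeff_def tanh_coeff_eq_0)
  then show ?thesis
    by (simp add: shifted_coeff_def tanh_coeff_diag tanh_coeff_eq_0)
qed

section \<open>Closed forms of the pivot products\<close>

lemma prod_factor_closed_form:
  "(\<Prod>l = 1..n. real l ^ 3 * (real l + 1) * (2 * real l + 1) ^ 3 * (2 * real l - 1) / 16) =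
     (real n + 1) * fact (2 * n + 1) ^ 3 * fact (2 * n) / 256 ^ n"
proof (induction n)
  case (Suc n)
  define x :: real where "x = fact (2 * n)"
  have f: "fact (2 * n + 1) = (2 * real n + 1) * x"
    "fact (2 * Suc n) = 2 * (real n + 1) * (2 * real n + 1) * x"
    "fact (2 * Suc n + 1) = (2 * real n + 3) * (2 * (real n + 1)) * (2 * real n + 1) * x"
    by (simp_all add: x_def algebra_simps)
  have c: "real (Suc n) = real n + 1" "real (Suc n) + 1 = real n + 2"
    "2 * real (Suc n) + 1 = 2 * real n + 3" "2 * real (Suc n) - 1 = 2 * real n + 1"
    by simp_all
  \<comment> \<open>Used with \<open>p, q, r, s\<close> as \<open>n + 1\<close>,
    \<open>2 * n + 1\<close>, \<open>2 * n + 3\<close>, \<open>n + 2\<close>, kept atomic so that no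
    sums are expanded.\<close>
  have generic: "p * (q * x) ^ 3 * x / W * (p ^ 3 * s * r ^ 3 * q / 16) =
      s * (r * (2 * p) * q * x) ^ 3 * (2 * p * q * x) / (256 * W)" for p q r s x W :: real
    by (simp add: power_mult_distrib eval_nat_numeral mult_ac)
  have "(\<Prod>l = 1..Suc n. real l ^ 3 * (real l + 1) * (2 * real l + 1) ^ 3 * (2 * real l - 1) / 16) =
     (real n + 1) * fact (2 * n + 1) ^ 3 * fact (2 * n) / 256 ^ n *
     ((real n + 1) ^ 3 * (real n + 2) * (2 * real n + 3) ^ 3 * (2 * real n + 1) / 16)"
    unfolding Suc.IH[symmetric] unfolding c[symmetric] by simp
  also have "\<dots> = (real (Suc n) + 1) * fact (2 * Suc n + 1) ^ 3 * fact (2 * Suc n) / 256 ^ Suc n"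
    unfolding f x_def[symmetric] generic by (simp add: add.commute)
  finally show ?case .
qed simp

lemma prod_power_Suc:
  fixes c :: "nat \<Rightarrow> 'a::comm_monoid_mult"
  shows "(\<Prod>l = 1..Suc n. c l ^ (Suc n + 1 - l)) =
    (\<Prod>l = 1..n. c l ^ (n + 1 - l)) * (\<Prod>l = 1..Suc n. c l)"
proof -
  have "(\<Prod>l = 1..n. c l ^ (Suc n + 1 - l)) = (\<Prod>l = 1..n. c l ^ (n + 1 - l) * c l)"
    by (rule prod.cong) (auto simp: Suc_diff_le mult.commute)
  then show ?thesis
    by (simp add: prod.distrib mult.assoc)
qed

text \<open>The factor that index \<open>2 * n\<close> adds to the determinant, hence the quotient
  of the two determinants.\<close>

lemma even_pivot_term:
  "pivot (2 * n) / 8 * (fact (2 * n) / 2 ^ (2 * n))\<^sup>2 =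
     - ((real n + 1) * (fact (2 * n + 1))\<^sup>2 / 2 ^ (4 * n + 2))"
proof -
  have "(2::real) ^ (4 * n + 2) = 4 * (2 ^ (2 * n))\<^sup>2"
    by (simp add: power_add power_mult[symmetric])
  then show ?thesis
    by (simp add: pivot_def pivot_ratio_def power2_eq_square divide_simps) (simp add: algebra_simps)
qed

lemma odd_pivot_term:
  "pivot (2 * n + 1) / 8 * (fact (2 * n + 1) / 2 ^ (2 * n + 1))\<^sup>2 =
     (2 * real n + 3) * (fact (2 * n + 2))\<^sup>2 / (32 * 2 ^ (4 * n)) * (odd_harm (Suc n) / odd_harm n)"
proof -
  have "(2::real) ^ (4 * n) = (2 ^ (2 * n))\<^sup>2"
    by (simp add: power_mult[symmetric])
  then show ?thesis
    by (simp add: pivot_def pivot_ratio_def power2_eq_square divide_simps)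
qed

text \<open>Each induction step adds one odd and one even pivot: the harmonic quotients telescope,
  and the rest supplies the new full product of \<open>prod_power_Suc\<close>.\<close>

lemma hankel_det_euler_even:
  "hankel_det (\<lambda>k. euler_poly (k + 3) 1) (2 * n) =
     (-1) ^ (n + 1) * odd_harm n / 2 ^ (3 * n + 2) *
     (\<Prod>l = 1..n. (real l ^ 3 * (real l + 1) * (2 * real l + 1) ^ 3 * (2 * real l - 1) / 16)
        ^ (n + 1 - l))"
proof (induction n)
  case 0
  show ?case
    by (simp add: hankel_det_euler_shifted pivot_def pivot_ratio_def odd_harm_def)
next
  case (Suc n)
  let ?c = "\<lambda>l. real l ^ 3 * (real l + 1) * (2 * real l + 1) ^ 3 * (2 * real l - 1) / 16"
  let ?H = "hankel_det (\<lambda>k. euler_poly (k + 3) 1)"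
  define P where "P = (\<Prod>l = 1..n. ?c l ^ (n + 1 - l))"
  define f :: real where "f = fact (2 * n + 2)"
  define w :: real where "w = 2 ^ n"
  have f: "fact (2 * Suc n) = f" "fact (2 * Suc n + 1) = (2 * real n + 3) * f"
    by (simp_all add: f_def algebra_simps)
  have w: "2 ^ (4 * n) = w ^ 4" "2 ^ (3 * n + 2) = 4 * w ^ 3" "2 ^ (4 * Suc n + 2) = 64 * w ^ 4"
     "2 ^ (3 * Suc n + 2) = 32 * w ^ 3" "256 ^ Suc n = 256 * w ^ 8"
  proof -
    have "(256::real) ^ n = w ^ 8"
      using power_mult[of "2::real" 8 n] by (simp add: w_def power_mult[symmetric] mult.commute)
    then show "256 ^ Suc n = 256 * w ^ 8"
      by simp
  qed (simp_all add: w_def power_add power_mult[symmetric] mult.commute)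
  have "w > 0" "f > 0" "odd_harm n > 0"
    by (simp_all add: w_def f_def odd_harm_pos)
  have sign: "(-1) ^ (Suc n + 1) = - ((-1) ^ (n + 1) :: real)"
    by simp
  have generic: "s * h / (4 * w ^ 3) * P * (r * f\<^sup>2 / (32 * w ^ 4) * (h' / h)) *
      (- (q * (r * f)\<^sup>2 / (64 * w ^ 4))) =
      - s * h' / (32 * w ^ 3) * (P * (q * (r * f) ^ 3 * f / (256 * w ^ 8)))"
    if "w \<noteq> 0" "h \<noteq> 0" for w h s P r f h' q :: real
    using that by (simp add: field_simps power_mult_distrib eval_nat_numeral)
  have "?H (2 * Suc n) = ?H (2 * n) *
      (pivot (2 * n + 1) / 8 * (fact (2 * n + 1) / 2 ^ (2 * n + 1))\<^sup>2) *
      (pivot (2 * Suc n) / 8 * (fact (2 * Suc n) / 2 ^ (2 * Suc n))\<^sup>2)"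
    unfolding hankel_det_euler_shifted by (simp add: mult.assoc)
  also have "\<dots> = (-1) ^ (n + 1) * odd_harm n / (4 * w ^ 3) * P *
      ((2 * real n + 3) * f\<^sup>2 / (32 * w ^ 4) * (odd_harm (Suc n) / odd_harm n)) *
      (- ((real n + 2) * ((2 * real n + 3) * f)\<^sup>2 / (64 * w ^ 4)))"
    unfolding odd_pivot_term even_pivot_term Suc.IH P_def[symmetric]
    unfolding f w f_def[symmetric] by (simp add: add.commute)
  also have "\<dots> = (-1) ^ (Suc n + 1) * odd_harm (Suc n) / (32 * w ^ 3) *
      (P * ((real n + 2) * ((2 * real n + 3) * f) ^ 3 * f / (256 * w ^ 8)))"
    unfolding sign by (rule generic) (use \<open>w > 0\<close> \<open>odd_harm n > 0\<close> in simp_all)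
  also have "P * ((real n + 2) * ((2 * real n + 3) * f) ^ 3 * f / (256 * w ^ 8)) =
      (\<Prod>l = 1..Suc n. ?c l ^ (Suc n + 1 - l))"
    unfolding prod_power_Suc prod_factor_closed_form f w P_def[symmetric] by (simp add: add.commute)
  finally show ?case
    unfolding w .
qed

theorem proposition5p2:
  fixes n :: nat
  assumes "n \<ge> 1"
  shows "hankel_det (\<lambda>k. euler_poly (k + 3) 1) (2 * n) /
           hankel_det (\<lambda>k. euler_poly (k + 3) 1) (2 * n - 1) =
         - ((real n + 1) * (fact (2 * n + 1))\<^sup>2 / 2 ^ (4 * n + 2)) \<and>
         hankel_det (\<lambda>k. euler_poly (k + 3) 1) (2 * n) =
         (-1) ^ (n + 1) * odd_harm n / 2 ^ (3 * n + 2) *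
         (\<Prod>l = 1..n. (real l ^ 3 * (real l + 1) * (2 * real l + 1) ^ 3 * (2 * real l - 1) / 16)
            ^ (n + 1 - l)) \<and>
         hankel_det (\<lambda>k. euler_poly (k + 3) 1) (2 * n - 1) =
         (-1) ^ n * 2 ^ n * odd_harm n / ((real n + 1) * (fact (2 * n + 1))\<^sup>2) *
         (\<Prod>l = 1..n. (real l ^ 3 * (real l + 1) * (2 * real l + 1) ^ 3 * (2 * real l - 1) / 16)
            ^ (n + 1 - l))"
proof -
  let ?H = "hankel_det (\<lambda>k. euler_poly (k + 3) 1)"
  define P where "P = (\<Prod>l = 1..n. (real l ^ 3 * (real l + 1) * (2 * real l + 1) ^ 3 *
    (2 * real l - 1) / 16) ^ (n + 1 - l))"
  define R :: real where "R = (real n + 1) * (fact (2 * n + 1))\<^sup>2"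
  have R: "R > 0"
    by (simp add: R_def)
  have even: "?H (2 * n) = (-1) ^ (n + 1) * odd_harm n / 2 ^ (3 * n + 2) * P"
    unfolding P_def by (rule hankel_det_euler_even)
  obtain m where m: "2 * n = Suc m" "m = 2 * n - 1"
    using assms by (cases "2 * n") auto
  have step: "?H (2 * n) = ?H (2 * n - 1) * - (R / 2 ^ (4 * n + 2))"
    unfolding R_def even_pivot_term[symmetric]
    unfolding hankel_det_euler_shifted m(2)[symmetric] by (simp add: m(1))
  have nz: "?H (2 * n - 1) \<noteq> 0"
    unfolding hankel_det_euler_shifted
    using pivot_ratio_pos by (auto simp: pivot_def less_imp_neq[symmetric])
  \<comment> \<open>The odd case needs no induction of its own: divide the even formula by its last
    factor.\<close>
  have "?H (2 * n - 1) = - (2 ^ (4 * n + 2) / R) * ?H (2 * n)"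
    unfolding step using R by simp
  also have "(2::real) ^ (4 * n + 2) = 2 ^ n * 2 ^ (3 * n + 2)"
    by (simp add: power_add[symmetric])
  finally have odd: "?H (2 * n - 1) = (-1) ^ n * 2 ^ n * odd_harm n / R * P"
    unfolding even using R by simp
  have "?H (2 * n) / ?H (2 * n - 1) = - (R / 2 ^ (4 * n + 2))"
    unfolding step using nz by simp
  with even odd show ?thesis
    unfolding P_def R_def by blast
qed

end
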